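(* Let $(X,d)$ be a compact metric space and $T:X\to X$ a function (not necessarily continuous). If $(X,T)$ has an uncountable weak scattering set $S\subset X$, then there is a set $S'$ with $\#(S')<\#(S)$ (cardinalities) such that every $x\in S\setminus S'$ has nontrivial orbit complexity.
   Context: A set $S\subset X$ is a weak scattering set if there is a $\delta>0$ such that for all $x,y\in S$ with $x\ne y$ one has $\limsup_{n\to\infty}d(T^n(x),T^n(y))>\delta$. Algorithmic information content. Let $\Sigma=\{0,1\}^*$ be the set of finite (possibly empty) binary strings and $|p|$ the length of $p\in\Sigma$. Fix a universal computing machine (universal partial recursive function) $\mathcal{U}$ taking binary strings as programs and giving as output strings over a finite alphabet, and a recursive injective encoding $(s',p)\mapsto\langle s',p\rangle$ of pairs of strings into strings, from which $\mathcal{U}$ can recover both components; universal means that it can emulate any other computing machine when given an appropriate fixed additional input. The conditional algorithmic information content is $AIC(s|s')=\min\{|p| : \mathcal{U}(\langle s',p\rangle)=s\}$. A natural number $n$ used as a condition is represented by its binary expansion. Orbit complexity. For a finite open cover $\beta=\{B_0,\dots,B_{N-1}\}$ of $X$ and $x\in X$ let $$\varphi_\beta(x)=\{\omega\in\{0,\dots,N-1\}^{\mathbb{N}} : \forall n\in\mathbb{N},\ T^n(x)\in B_{\omega(n)}\}.$$ Let $\omega^n$ denote the string of the first $n$ digits of $\omega$, and put $\hat{K}(x,T,\beta,n)=\min_{\omega\in\varphi_\beta(x)}AIC(\omega^n|n)$. For a monotonic function $f:\mathbb{N}\to\mathbb{R}$ with $\lim_{n\to\infty}f(n)=\infty$ let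 $\hat{K}^f(x,T,\beta)=\limsup_{n\to\infty}\hat{K}(x,T,\beta,n)/f(n)$ and $\hat{K}^f(x)=\hat{K}^f(x,T)=\sup_\beta\hat{K}^f(x,T,\beta)$, the supremum being over all finite open covers $\beta$ of $X$. A point $x$ has nontrivial orbit complexity if there exists a monotonic $f$ with $\lim_{n\to\infty} f(n)=\infty$ such that $\hat{K}^f(x)>0$. *)

theory Defs
  imports "HOL-Analysis.Analysis" "HOL-Library.Nat_Bijection" "HOL-Library.Equipollence"
begin

section \<open>Partial recursive functions\<close>

text \<open>
  Kleene's partial recursive functions. A function of arity n is given as a function on
  argument lists, with \<^const>\<open>None\<close> for divergence; only its values on lists of length n
  are meaningful.
\<close>

inductive partial_recursive :: "nat \<Rightarrow> (nat list \<Rightarrow> nat option) \<Rightarrow> bool" where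
  zero: "partial_recursive n (\<lambda>xs. Some 0)"
| succ: "partial_recursive 1 (\<lambda>xs. Some (Suc (hd xs)))"
| proj: "i < n \<Longrightarrow> partial_recursive n (\<lambda>xs. Some (xs ! i))"
| comp: "partial_recursive (length gs) f \<Longrightarrow> (\<forall>g\<in>set gs. partial_recursive n g) \<Longrightarrow>
    partial_recursive n (\<lambda>xs. Option.bind (those (map (\<lambda>g. g xs) gs)) f)"
| prec: "partial_recursive n f \<Longrightarrow> partial_recursive (Suc (Suc n)) g \<Longrightarrow>
    partial_recursive (Suc n)
      (\<lambda>xs. rec_nat (f (tl xs)) (\<lambda>k r. Option.bind r (\<lambda>v. g (k # v # tl xs))) (hd xs))"
| mu: "partial_recursive (Suc n) f \<Longrightarrow>
    partial_recursive n
      (\<lambda>xs. if \<exists>k. f (k # xs) = Some 0 \<and> (\<forall>j<k. f (j # xs) \<noteq> None)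
            then Some (LEAST k. f (k # xs) = Some 0) else None)"

section \<open>Computing machines and algorithmic information content\<close>

text \<open>
  Programs and conditions are binary strings. Outputs are strings over some finite alphabet
  {0, ..., N - 1}; since N depends on the open cover, they are represented as lists of natural
  numbers. Recursiveness of functions on strings is taken with respect to the standard
  computable coding \<^const>\<open>list_encode\<close> of lists by numbers.
\<close>

definition bin_code :: "bool list \<Rightarrow> nat" where
  "bin_code p = list_encode (map of_bool p)"

definition computing_machine :: "(bool list \<Rightarrow> nat list option) \<Rightarrow> bool" where
  "computing_machine M \<longleftrightarrow>
     (\<exists>f. partial_recursive 1 f \<and> (\<forall>p. f [bin_code p] = map_option list_encode (M p)))"

definition recursive_pairing :: "(bool list \<Rightarrow> bool list \<Rightarrow> bool list) \<Rightarrow> bool" where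
  "recursive_pairing pair \<longleftrightarrow>
     (\<forall>s p s' p'. pair s p = pair s' p' \<longrightarrow> s = s' \<and> p = p') \<and>
     (\<exists>f. partial_recursive 2 f \<and>
        (\<forall>s p. f [bin_code s, bin_code p] = Some (bin_code (pair s p)))) \<and>
     (\<exists>f. partial_recursive 1 f \<and> (\<forall>s p. f [bin_code (pair s p)] = Some (bin_code s))) \<and>
     (\<exists>f. partial_recursive 1 f \<and> (\<forall>s p. f [bin_code (pair s p)] = Some (bin_code p)))"

text \<open>
  The fixed additional input that makes U emulate M is a prefix of the program, the condition
  s being passed on unchanged. Machines that ignore the condition are a special case, as both
  components of a pair are computable from it.
\<close>

definition universal_machine ::
  "(bool list \<Rightarrow> nat list option) \<Rightarrow> (bool list \<Rightarrow> bool list \<Rightarrow> bool list) \<Rightarrow> bool" where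
  "universal_machine U pair \<longleftrightarrow>
     computing_machine U \<and> recursive_pairing pair \<and>
     (\<forall>M. computing_machine M \<longrightarrow> (\<exists>q. \<forall>s p. U (pair s (q @ p)) = M (pair s p)))"

text \<open>For universal machines the minimum is attained, see \<open>AIC_attained\<close> below.\<close>

definition AIC ::
  "(bool list \<Rightarrow> nat list option) \<Rightarrow> (bool list \<Rightarrow> bool list \<Rightarrow> bool list) \<Rightarrow>
   nat list \<Rightarrow> bool list \<Rightarrow> nat" where
  "AIC U pair s s' = (LEAST k. \<exists>p. length p = k \<and> U (pair s' p) = Some s)"

fun binary_expansion :: "nat \<Rightarrow> bool list" where
  "binary_expansion n = (if n < 2 then [n = 1] else binary_expansion (n div 2) @ [odd n])"

declare binary_expansion.simps [simp del]

lemma partial_recursive_const: "partial_recursive n (\<lambda>xs. Some c)"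
proof (induction c)
  case 0
  show ?case by (rule partial_recursive.zero)
next
  case (Suc c)
  have "partial_recursive n (\<lambda>xs. Option.bind (those (map (\<lambda>g. g xs) [\<lambda>xs. Some c]))
          (\<lambda>xs. Some (Suc (hd xs))))"
    using Suc partial_recursive.succ by (intro partial_recursive.comp) auto
  then show ?case by simp
qed

lemma AIC_attained:
  assumes "universal_machine U pair"
  shows "\<exists>p. length p = AIC U pair s s' \<and> U (pair s' p) = Some s"
proof -
  have "computing_machine (\<lambda>_. Some s)"
    unfolding computing_machine_def
    using partial_recursive_const[of 1 "list_encode s"] by auto
  then obtain q where "\<forall>t p. U (pair t (q @ p)) = Some s"
    using assms unfolding universal_machine_def by blast
  then have "\<exists>k p. length p = k \<and> U (pair s' p) = Some s"
    by blast
  then show ?thesis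
    unfolding AIC_def by (rule LeastI_ex)
qed

section \<open>Orbit complexity\<close>

text \<open>A cover by N sets is given by an enumeration of its members.\<close>

definition finite_open_cover :: "'a::topological_space set list \<Rightarrow> bool" where
  "finite_open_cover \<beta> \<longleftrightarrow> distinct \<beta> \<and> (\<forall>B\<in>set \<beta>. open B) \<and> \<Union> (set \<beta>) = UNIV"

definition itineraries :: "('a \<Rightarrow> 'a) \<Rightarrow> 'a set list \<Rightarrow> 'a \<Rightarrow> (nat \<Rightarrow> nat) set" where
  "itineraries T \<beta> x = {\<omega>. \<forall>n. \<omega> n < length \<beta> \<and> (T ^^ n) x \<in> \<beta> ! \<omega> n}"

definition orbit_AIC ::
  "(bool list \<Rightarrow> nat list option) \<Rightarrow> (bool list \<Rightarrow> bool list \<Rightarrow> bool list) \<Rightarrow>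
   ('a \<Rightarrow> 'a) \<Rightarrow> 'a set list \<Rightarrow> 'a \<Rightarrow> nat \<Rightarrow> nat" where
  "orbit_AIC U pair T \<beta> x n =
     (LEAST k. \<exists>\<omega>\<in>itineraries T \<beta> x. k = AIC U pair (map \<omega> [0..<n]) (binary_expansion n))"

definition cover_complexity ::
  "(bool list \<Rightarrow> nat list option) \<Rightarrow> (bool list \<Rightarrow> bool list \<Rightarrow> bool list) \<Rightarrow>
   (nat \<Rightarrow> real) \<Rightarrow> ('a \<Rightarrow> 'a) \<Rightarrow> 'a set list \<Rightarrow> 'a \<Rightarrow> ereal" where
  "cover_complexity U pair f T \<beta> x =
     limsup (\<lambda>n. ereal (real (orbit_AIC U pair T \<beta> x n) / f n))"

definition orbit_complexity ::
  "(bool list \<Rightarrow> nat list option) \<Rightarrow> (bool list \<Rightarrow> bool list \<Rightarrow> bool list) \<Rightarrow>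
   (nat \<Rightarrow> real) \<Rightarrow> ('a::topological_space \<Rightarrow> 'a) \<Rightarrow> 'a \<Rightarrow> ereal" where
  "orbit_complexity U pair f T x =
     (SUP \<beta>\<in>{\<beta>. finite_open_cover \<beta>}. cover_complexity U pair f T \<beta> x)"

definition nontrivial_orbit_complexity ::
  "(bool list \<Rightarrow> nat list option) \<Rightarrow> (bool list \<Rightarrow> bool list \<Rightarrow> bool list) \<Rightarrow>
   ('a::topological_space \<Rightarrow> 'a) \<Rightarrow> 'a \<Rightarrow> bool" where
  "nontrivial_orbit_complexity U pair T x \<longleftrightarrow>
     (\<exists>f. mono f \<and> filterlim f at_top sequentially \<and> orbit_complexity U pair f T x > 0)"

section \<open>Weak scattering sets\<close>

definition weak_scattering_set :: "('a::metric_space \<Rightarrow> 'a) \<Rightarrow> 'a set \<Rightarrow> bool" where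
  "weak_scattering_set T S \<longleftrightarrow>
     (\<exists>\<delta>>0. \<forall>x\<in>S. \<forall>y\<in>S. x \<noteq> y \<longrightarrow>
        limsup (\<lambda>n. ereal (dist ((T ^^ n) x) ((T ^^ n) y))) > ereal \<delta>)"

end

theory Submission
  imports Defs
begin

text \<open>
  Fix a finite open cover whose members have diameter at most the separation constant of the
  weak scattering set. Itineraries of distinct points of the set then differ at some time,
  whatever itineraries are chosen, because the two orbits get too far apart to lie in a
  common member of the cover.

  Suppose that every orbit prefix of each point of a finite set \<open>F\<close> of scattered points has a
  description of length at most \<open>C\<close>. At a single time \<open>n\<close>, late enough to
  separate all pairs of points of \<open>F\<close>, the descriptions of length-\<open>n\<close> prefixes are pairwise
  different (the condition \<open>n\<close> being the same for all of them), so \<open>F\<close> has at most as many points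
  as there are programs of length at most \<open>C\<close> (\<open>finite_bounded_orbit_AIC\<close>). Hence only finitely
  many scattered points have complexity bounded by \<open>C\<close>, and only countably many have bounded
  complexity. Conversely, an unbounded sequence has limit superior at least 1 relative to its
  own running maximum (\<open>unbounded_imp_nontrivial\<close>), so all other points have nontrivial orbit
  complexity. A countable set is strictly smaller than an uncountable one.
\<close>

text \<open>
  At each of its infinitely many record times, an unbounded sequence equals its running maximum.
\<close>

lemma unbounded_imp_limsup_running_max:
  fixes K :: "nat \<Rightarrow> nat"
  assumes unbounded: "\<And>C. \<exists>n. K n > C"
  shows "\<exists>f. mono f \<and> filterlim f at_top sequentially \<and>
           limsup (\<lambda>n. ereal (real (K n) / f n)) > 0"
proof -
  define f where "f n = real (Max (K ` {..n}))" for n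
  have K_le: "K i \<le> Max (K ` {..n})" if "i \<le> n" for i n
    using that by (intro Max_ge) auto
  have mono: "mono f"
    unfolding f_def mono_def by (auto intro!: Max_mono)
  have lim: "filterlim f at_top sequentially"
    unfolding filterlim_at_top
  proof
    fix Z :: real
    obtain C :: nat where "Z \<le> real C"
      using real_arch_simple by blast
    moreover obtain m where "K m > C"
      using unbounded by blast
    ultimately have "Z \<le> f n" if "n \<ge> m" for n
      using K_le[OF that] unfolding f_def by linarith
    then show "\<forall>\<^sub>F n in sequentially. Z \<le> f n"
      unfolding eventually_sequentially by blast
  qed
  have records: "\<exists>n\<ge>N. real (K n) / f n = 1" for N
  proof -
    define m where "m = (LEAST m. K m > Max (K ` {..N}))"
    have m: "K m > Max (K ` {..N})"
      unfolding m_def using unbounded by (rule LeastI_ex)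
    have "\<not> K i > Max (K ` {..N})" if "i < m" for i
      using that not_less_Least unfolding m_def by blast
    with m have "K i \<le> K m" if "i \<le> m" for i
      using that by (metis le_less not_le order.strict_trans1)
    then have "Max (K ` {..m}) = K m"
      by (intro Max_eqI) auto
    moreover have "N \<le> m"
      using m K_le[of m N] by linarith
    ultimately show ?thesis
      using m by (intro exI[of _ m]) (auto simp: f_def)
  qed
  have "limsup (\<lambda>n. ereal (real (K n) / f n)) \<ge> 1"
  proof (rule ccontr)
    assume "\<not> ?thesis"
    then have "limsup (\<lambda>n. ereal (real (K n) / f n)) < 1"
      by simp
    then have "\<forall>\<^sub>F n in sequentially. ereal (real (K n) / f n) < 1"
      by (rule Limsup_lessD)
    then obtain N where "\<And>n. n \<ge> N \<Longrightarrow> ereal (real (K n) / f n) < 1"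
      unfolding eventually_sequentially by blast
    with records[of N] show False
      by fastforce
  qed
  then have "limsup (\<lambda>n. ereal (real (K n) / f n)) > 0"
    by (rule less_le_trans[rotated]) simp
  with mono lim show ?thesis
    by blast
qed

lemma unbounded_imp_nontrivial:
  assumes "finite_open_cover \<beta>"
    and "\<And>C. \<exists>n. orbit_AIC U pair T \<beta> x n > C"
  shows "nontrivial_orbit_complexity U pair T x"
proof -
  obtain f where f: "mono f" "filterlim f at_top sequentially"
      "cover_complexity U pair f T \<beta> x > 0"
    using unbounded_imp_limsup_running_max[of "orbit_AIC U pair T \<beta> x"] assms(2)
    unfolding cover_complexity_def by blast
  have "cover_complexity U pair f T \<beta> x \<le> orbit_complexity U pair f T x"
    unfolding orbit_complexity_def using assms(1) by (intro SUP_upper) auto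
  with f show ?thesis
    unfolding nontrivial_orbit_complexity_def by (meson less_le_trans)
qed

text \<open>
  Covering guarantees an itinerary, and universality guarantees a program, so both minima in
  the orbit complexity are attained.
\<close>

lemma orbit_AIC_attained:
  assumes "universal_machine U pair" and "finite_open_cover \<beta>"
  shows "\<exists>p \<omega>. length p = orbit_AIC U pair T \<beta> x n \<and> \<omega> \<in> itineraries T \<beta> x \<and>
           U (pair (binary_expansion n) p) = Some (map \<omega> [0..<n])"
proof -
  have "\<exists>i<length \<beta>. (T ^^ k) x \<in> \<beta> ! i" for k
    using assms(2) unfolding finite_open_cover_def
    by (metis UNIV_I UnionE in_set_conv_nth)
  then obtain \<omega>' where "\<omega>' \<in> itineraries T \<beta> x"
    unfolding itineraries_def by simp metis
  then have "\<exists>k. \<exists>\<omega>\<in>itineraries T \<beta> x. k = AIC U pair (map \<omega> [0..<n]) (binary_expansion n)"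
    by blast
  from LeastI_ex[OF this] obtain \<omega> where \<omega>: "\<omega> \<in> itineraries T \<beta> x"
    "orbit_AIC U pair T \<beta> x n = AIC U pair (map \<omega> [0..<n]) (binary_expansion n)"
    unfolding orbit_AIC_def by blast
  with AIC_attained[OF assms(1), of "map \<omega> [0..<n]" "binary_expansion n"] show ?thesis
    by metis
qed

lemma finite_open_cover_small_members:
  fixes \<delta> :: real
  assumes "compact (UNIV :: 'a::metric_space set)" and "\<delta> > 0"
  shows "\<exists>\<beta> :: 'a set list. finite_open_cover \<beta> \<and>
           (\<forall>B\<in>set \<beta>. \<forall>x\<in>B. \<forall>y\<in>B. dist x y < \<delta>)"
proof -
  have "(UNIV :: 'a set) \<subseteq> (\<Union>c\<in>UNIV. ball c (\<delta> / 2))"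
    using assms(2) by fastforce
  with assms(1) obtain C :: "'a set"
    where C: "finite C" "UNIV \<subseteq> (\<Union>c\<in>C. ball c (\<delta> / 2))"
    by (metis compactE_image open_ball)
  obtain \<beta> where \<beta>: "set \<beta> = (\<lambda>c. ball c (\<delta> / 2)) ` C" "distinct \<beta>"
    using finite_distinct_list[of "(\<lambda>c. ball c (\<delta> / 2)) ` C"] C(1) by blast
  have "dist x y < \<delta>" if "x \<in> ball c (\<delta> / 2)" "y \<in> ball c (\<delta> / 2)" for x y c :: 'a
    using that dist_triangle_half_r[of c x \<delta> y] by simp
  moreover have "finite_open_cover \<beta>"
    using \<beta> C(2) unfolding finite_open_cover_def by auto
  ultimately show ?thesis
    using \<beta>(1) by (intro exI[of _ \<beta>]) auto
qed

lemma weak_scattering_set_separates: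
  assumes "weak_scattering_set T S"
  shows "\<exists>\<delta>>0. \<forall>x\<in>S. \<forall>y\<in>S. x \<noteq> y \<longrightarrow> (\<exists>k. dist ((T ^^ k) x) ((T ^^ k) y) > \<delta>)"
proof -
  obtain \<delta> where "\<delta> > 0" and
    \<delta>: "\<And>x y. x \<in> S \<Longrightarrow> y \<in> S \<Longrightarrow> x \<noteq> y \<Longrightarrow>
          limsup (\<lambda>n. ereal (dist ((T ^^ n) x) ((T ^^ n) y))) > ereal \<delta>"
    using assms unfolding weak_scattering_set_def by blast
  have "\<exists>k. dist ((T ^^ k) x) ((T ^^ k) y) > \<delta>" if "x \<in> S" "y \<in> S" "x \<noteq> y" for x y
  proof (rule ccontr)
    assume "\<not> ?thesis"
    then have "limsup (\<lambda>n. ereal (dist ((T ^^ n) x) ((T ^^ n) y))) \<le> ereal \<delta>"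
      by (intro Limsup_bounded always_eventually) (auto simp: not_less)
    with \<delta>[OF that] show False
      by simp
  qed
  with \<open>\<delta> > 0\<close> show ?thesis
    by blast
qed

text \<open>
  Finitely many pairs are separated before a common time \<open>n\<close>; at that time a program determines,
  for given \<open>n\<close>, an orbit prefix that fits only one of the points. So every finite subset is
  bounded in size by the number of programs of length at most \<open>C\<close>.
\<close>

lemma finite_bounded_orbit_AIC:
  fixes T :: "'a::metric_space \<Rightarrow> 'a"
  assumes universal: "universal_machine U pair"
    and cover: "finite_open_cover \<beta>"
    and small: "\<And>B x y. B \<in> set \<beta> \<Longrightarrow> x \<in> B \<Longrightarrow> y \<in> B \<Longrightarrow> dist x y < \<delta>"
    and separated: "\<And>x y. x \<in> S \<Longrightarrow> y \<in> S \<Longrightarrow> x \<noteq> y \<Longrightarrow>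
          \<exists>k. dist ((T ^^ k) x) ((T ^^ k) y) > \<delta>"
  shows "finite {x\<in>S. \<forall>n. orbit_AIC U pair T \<beta> x n \<le> C}"
proof -
  let ?P = "{p :: bool list. length p \<le> C}"
  have "finite ?P"
    using finite_lists_length_le[of "UNIV :: bool set" C] by simp
  have "card F \<le> card ?P"
    if F: "F \<subseteq> {x\<in>S. \<forall>n. orbit_AIC U pair T \<beta> x n \<le> C}" "finite F" for F
  proof -
    obtain k where k: "\<And>x y. x \<in> F \<Longrightarrow> y \<in> F \<Longrightarrow> x \<noteq> y \<Longrightarrow>
        dist ((T ^^ k x y) x) ((T ^^ k x y) y) > \<delta>"
      using separated F(1) by (metis (mono_tags, lifting) mem_Collect_eq subsetD)
    define n where "n = Suc (Max ((\<lambda>(x, y). k x y) ` (F \<times> F)))"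
    have k_less: "k x y < n" if "x \<in> F" "y \<in> F" for x y
      using that F(2) unfolding n_def less_Suc_eq_le by (intro Max_ge) auto
    have "\<forall>x. \<exists>p \<omega>. length p = orbit_AIC U pair T \<beta> x n \<and> \<omega> \<in> itineraries T \<beta> x \<and>
        U (pair (binary_expansion n) p) = Some (map \<omega> [0..<n])"
      by (intro allI orbit_AIC_attained[OF universal cover])
    then obtain p \<omega> where "\<forall>x. length (p x) = orbit_AIC U pair T \<beta> x n \<and>
        \<omega> x \<in> itineraries T \<beta> x \<and>
        U (pair (binary_expansion n) (p x)) = Some (map (\<omega> x) [0..<n])"
      unfolding choice_iff by (elim exE)
    then have p: "length (p x) = orbit_AIC U pair T \<beta> x n"
        "U (pair (binary_expansion n) (p x)) = Some (map (\<omega> x) [0..<n])"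
      and \<omega>: "\<omega> x \<in> itineraries T \<beta> x" for x
      by simp_all
    have "inj_on p F"
    proof (rule inj_onI, rule ccontr)
      fix x y assume xy: "x \<in> F" "y \<in> F" "p x = p y" "x \<noteq> y"
      then have "map (\<omega> x) [0..<n] = map (\<omega> y) [0..<n]"
        using p(2)[of x] p(2)[of y] by simp
      then have same: "\<omega> x (k x y) = \<omega> y (k x y)"
        using k_less[OF xy(1,2)] by simp
      have member: "\<omega> z j < length \<beta>" "(T ^^ j) z \<in> \<beta> ! \<omega> z j" for z j
        using \<omega>[of z] unfolding itineraries_def by auto
      have "dist ((T ^^ k x y) x) ((T ^^ k x y) y) < \<delta>"
        using small[OF nth_mem[OF member(1)] member(2)] member(2) same by simp
      with k[OF xy(1,2,4)] show False
        by simp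
    qed
    moreover have "p ` F \<subseteq> ?P"
      using F(1) p(1) by auto
    ultimately show ?thesis
      using \<open>finite ?P\<close> by (intro card_inj_on_le)
  qed
  then show ?thesis
    by (rule finite_if_finite_subsets_card_bdd[THEN conjunct1])
qed

theorem theorem14:
  fixes T :: "'a::metric_space \<Rightarrow> 'a"
    and S :: "'a set"
    and U :: "bool list \<Rightarrow> nat list option"
    and pair :: "bool list \<Rightarrow> bool list \<Rightarrow> bool list"
  assumes "compact (UNIV :: 'a set)"
    and "universal_machine U pair"
    and "weak_scattering_set T S"
    and "uncountable S"
  shows "\<exists>S'. S' \<prec> S \<and> (\<forall>x\<in>S - S'. nontrivial_orbit_complexity U pair T x)"
proof -
  obtain \<delta> where "\<delta> > 0" and separated: "\<And>x y. x \<in> S \<Longrightarrow> y \<in> S \<Longrightarrow> x \<noteq> y \<Longrightarrow>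
      \<exists>k. dist ((T ^^ k) x) ((T ^^ k) y) > \<delta>"
    using weak_scattering_set_separates[OF assms(3)] by blast
  obtain \<beta> :: "'a set list" where cover: "finite_open_cover \<beta>"
    and small: "\<And>B x y. B \<in> set \<beta> \<Longrightarrow> x \<in> B \<Longrightarrow> y \<in> B \<Longrightarrow> dist x y < \<delta>"
    using finite_open_cover_small_members[OF assms(1) \<open>\<delta> > 0\<close>] by blast
  define S' where "S' = (\<Union>C. {x\<in>S. \<forall>n. orbit_AIC U pair T \<beta> x n \<le> C})"
  have "countable S'"
    unfolding S'_def
    using finite_bounded_orbit_AIC[OF assms(2) cover small separated]
    by (intro countable_UN) (auto intro: countable_finite)
  moreover have "S' \<lesssim> S"
    unfolding S'_def by (intro subset_imp_lepoll) auto
  moreover have "\<not> S \<lesssim> S'"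
    using \<open>countable S'\<close> assms(4) countable_lepoll by blast
  ultimately have "S' \<prec> S"
    unfolding lesspoll_def by (metis eqpoll_imp_lepoll eqpoll_sym)
  moreover have "nontrivial_orbit_complexity U pair T x" if "x \<in> S - S'" for x
  proof (rule unbounded_imp_nontrivial[OF cover])
    show "\<exists>n. orbit_AIC U pair T \<beta> x n > C" for C
      using that unfolding S'_def by (auto simp: not_le)
  qed
  ultimately show ?thesis
    by blast
qed

end
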